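(* Let $C$ be a curve in a Myller configuration $M(C,\bar\xi,\pi)$ with alternative frame $R_A=\{P(s);\bar\xi_2,\bar Y,\bar D\}$ and (nowhere) non-zero alternative curvatures $p,q$. Then $C$ is a slant helix (equivalently, a Darboux helix) if and only if $\bar\xi_2$ satisfies the differential equation $$\bar\xi_2'''-\left[\frac{p'}{p}+\frac{(pq)'}{pq}\right]\bar\xi_2''+\left\{pq\left[\left(\frac1p\right)'\frac1q\right]'+p^2+q^2\right\}\bar\xi_2'=0.$$
   Context: All data are smooth. Let $C$ be a curve in Euclidean space $E^3$ with arclength parameter $s\in I$ ($I$ an interval) and position vector $\bar r(s)$, let $\bar\xi(s)$ be a unit vector field along $C$ (a versor field $(C,\bar\xi)$), and let $\pi(s)$ be a plane field along $C$ with $\bar\xi(s)\in\pi(s)$. The pair $((C,\bar\xi),(C,\pi))$ is called a Myller configuration $M=M(C,\bar\xi,\pi)$. Put $\bar\xi_1=\bar\xi$, $K_1=\|d\bar\xi/ds\|>0$ (curvature), define $\bar\xi_2$ by $\bar\xi_1'=K_1\bar\xi_2$, and $\bar\xi_3=\bar\xi_1\times\bar\xi_2$. Then $\{\bar\xi_1,\bar\xi_2,\bar\xi_3\}$ is a positively oriented orthonormal frame, the Frenet-type frame $R_F$, and $$\bar\xi_1'=K_1\bar\xi_2,\quad \bar\xi_2'=-K_1\bar\xi_1+K_2\bar\xi_3,\quad \bar\xi_3'=-K_2\bar\xi_2,$$ which defines the torsion $K_2$. A prime denotes $d/ds$. The alternative frame (AF-frame) is the orthonormal frame $R_A=\{P(s);\bar\xi_2,\bar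 Y,\bar D\}$ with $\bar Y=\bar\xi_2'/\|\bar\xi_2'\|$ and $\bar D=\bar\xi_2\times\bar Y=\frac{K_2}{\sqrt{K_1^2+K_2^2}}\bar\xi_1+\frac{K_1}{\sqrt{K_1^2+K_2^2}}\bar\xi_3$. It satisfies $\bar\xi_2'=p\bar Y$, $\bar Y'=-p\bar\xi_2+q\bar D$, $\bar D'=-q\bar Y$, where the alternative curvatures are $p=\sqrt{K_1^2+K_2^2}$ and $q=\frac{K_1^2}{K_1^2+K_2^2}\left(\frac{K_2}{K_1}\right)'$. The curve $C$ is called a slant helix (or $\bar\xi_2$-helix) in $M$ if $\bar\xi_2$ makes a constant angle with a fixed unit vector, and a Darboux helix in $M$ if $\bar D$ makes a constant angle with a constant unit vector. *)

theory Defs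
  imports "HOL-Analysis.Analysis"
begin

(* Derivatives are taken within the parameter interval I, so that end points of I, if any,
   are covered by one-sided derivatives.  Only values at points of I are meaningful. *)

definition D :: "real set \<Rightarrow> (real \<Rightarrow> 'a::real_normed_vector) \<Rightarrow> real \<Rightarrow> 'a" where
  "D I f = (\<lambda>s. vector_derivative f (at s within I))"

definition smooth_in :: "real set \<Rightarrow> (real \<Rightarrow> 'a::real_normed_vector) \<Rightarrow> bool" where
  "smooth_in I f \<longleftrightarrow> (\<forall>n. \<forall>s\<in>I. (D I ^^ n) f differentiable (at s within I))"

(* The plane at r s is identified with its direction, a two-dimensional linear subspace of the
   tangent space at r s.  It is smooth if it has a smooth unit normal field; since I is an
   interval, a global normal exists as soon as local ones do. *)

definition smooth_plane_field :: "real set \<Rightarrow> (real \<Rightarrow> (real^3) set) \<Rightarrow> bool" where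
  "smooth_plane_field I \<pi> \<longleftrightarrow>
     (\<exists>\<nu>. smooth_in I \<nu> \<and> (\<forall>s\<in>I. norm (\<nu> s) = 1 \<and> \<pi> s = {v. \<nu> s \<bullet> v = 0}))"

definition myller_configuration ::
    "real set \<Rightarrow> (real \<Rightarrow> real^3) \<Rightarrow> (real \<Rightarrow> real^3) \<Rightarrow> (real \<Rightarrow> (real^3) set) \<Rightarrow> bool" where
  "myller_configuration I r \<xi> \<pi> \<longleftrightarrow>
     is_interval I \<and> interior I \<noteq> {} \<and>
     smooth_in I r \<and> (\<forall>s\<in>I. norm (D I r s) = 1) \<and>
     smooth_in I \<xi> \<and> (\<forall>s\<in>I. norm (\<xi> s) = 1) \<and>
     smooth_plane_field I \<pi> \<and> (\<forall>s\<in>I. \<xi> s \<in> \<pi> s)"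

definition K1 :: "real set \<Rightarrow> (real \<Rightarrow> real^3) \<Rightarrow> real \<Rightarrow> real" where
  "K1 I \<xi> s = norm (D I \<xi> s)"

definition xi2 :: "real set \<Rightarrow> (real \<Rightarrow> real^3) \<Rightarrow> real \<Rightarrow> real^3" where
  "xi2 I \<xi> s = D I \<xi> s /\<^sub>R K1 I \<xi> s"

definition xi3 :: "real set \<Rightarrow> (real \<Rightarrow> real^3) \<Rightarrow> real \<Rightarrow> real^3" where
  "xi3 I \<xi> s = cross3 (\<xi> s) (xi2 I \<xi> s)"

(* The coefficient of xi3 in xi2' = - K1 xi + K2 xi3, the frame being orthonormal. *)

definition K2 :: "real set \<Rightarrow> (real \<Rightarrow> real^3) \<Rightarrow> real \<Rightarrow> real" where
  "K2 I \<xi> s = D I (xi2 I \<xi>) s \<bullet> xi3 I \<xi> s"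

definition AF_Y :: "real set \<Rightarrow> (real \<Rightarrow> real^3) \<Rightarrow> real \<Rightarrow> real^3" where
  "AF_Y I \<xi> s = D I (xi2 I \<xi>) s /\<^sub>R norm (D I (xi2 I \<xi>) s)"

definition AF_D :: "real set \<Rightarrow> (real \<Rightarrow> real^3) \<Rightarrow> real \<Rightarrow> real^3" where
  "AF_D I \<xi> s = cross3 (xi2 I \<xi> s) (AF_Y I \<xi> s)"

definition AF_p :: "real set \<Rightarrow> (real \<Rightarrow> real^3) \<Rightarrow> real \<Rightarrow> real" where
  "AF_p I \<xi> s = sqrt ((K1 I \<xi> s)\<^sup>2 + (K2 I \<xi> s)\<^sup>2)"

definition AF_q :: "real set \<Rightarrow> (real \<Rightarrow> real^3) \<Rightarrow> real \<Rightarrow> real" where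
  "AF_q I \<xi> s = (K1 I \<xi> s)\<^sup>2 / ((K1 I \<xi> s)\<^sup>2 + (K2 I \<xi> s)\<^sup>2)
                 * D I (\<lambda>t. K2 I \<xi> t / K1 I \<xi> t) s"

definition vec_angle :: "real^3 \<Rightarrow> real^3 \<Rightarrow> real" where
  "vec_angle u v = arccos (u \<bullet> v / (norm u * norm v))"

definition makes_constant_angle :: "real set \<Rightarrow> (real \<Rightarrow> real^3) \<Rightarrow> bool" where
  "makes_constant_angle I X \<longleftrightarrow>
     (\<exists>u. norm u = 1 \<and> (\<lambda>s. vec_angle (X s) u) constant_on I)"

definition slant_helix :: "real set \<Rightarrow> (real \<Rightarrow> real^3) \<Rightarrow> bool" where
  "slant_helix I \<xi> \<longleftrightarrow> makes_constant_angle I (xi2 I \<xi>)"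

definition darboux_helix :: "real set \<Rightarrow> (real \<Rightarrow> real^3) \<Rightarrow> bool" where
  "darboux_helix I \<xi> \<longleftrightarrow> makes_constant_angle I (AF_D I \<xi>)"

end

theory Submission
  imports Defs
begin

text \<open>Write \<open>X\<close>, \<open>Y\<close>, \<open>W\<close> for the alternative frame and \<open>p\<close>, \<open>q\<close> for its curvatures, so that
  \<open>X' = p Y\<close>, \<open>Y' = - p X + q W\<close>, \<open>W' = - q Y\<close>.  Both parts rest on one condition: there is a
  fixed unit vector \<open>u\<close> orthogonal to every \<open>Y s\<close>.

  Since \<open>(X \<bullet> u)' = p (Y \<bullet> u)\<close> and \<open>(W \<bullet> u)' = - q (Y \<bullet> u)\<close> with \<open>p\<close> and \<open>q\<close> nowhere zero, a fixed
  \<open>u\<close> makes a constant angle with \<open>X\<close> exactly when it is orthogonal to all \<open>Y s\<close>, and the same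
  holds for \<open>W\<close>.  Hence slant helices and Darboux helices are the same curves, with the same axes
  (\<open>constant_angle_X_iff\<close>, \<open>constant_angle_W_iff\<close>).

  Such a \<open>u\<close> exists exactly when \<open>q / p\<close> is constant (\<open>fixed_normal_iff_proportional\<close>).
  Differentiating \<open>Y \<bullet> u = 0\<close> gives \<open>p (X \<bullet> u) = q (W \<bullet> u)\<close> with constant inner products that are
  both nonzero, because otherwise \<open>u\<close> would vanish.  Conversely, if \<open>q / p\<close> is constant, the
  vector \<open>(q / p) X + W\<close> has derivative zero and is orthogonal to \<open>Y\<close>.

  Finally, expanding the derivatives of \<open>X\<close> up to the third order in the frame, the coefficients
  in the differential equation turn out to be exactly those that annihilate the components along
  \<open>Y\<close> and \<open>W\<close>; what remains is \<open>p / q (p q' - q p') X\<close> (\<open>differential_expression_eq\<close>).  So the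
  equation says that \<open>q / p\<close> is constant.

  The frame equations themselves follow from \<open>\<xi>\<^sub>2' = - K1 \<xi> + K2 \<xi>\<^sub>3\<close>, where \<open>\<xi>\<^sub>2 = X\<close>, by comparing inner products;
  that all the functions involved are differentiable often enough is a consequence of the
  positivity of \<open>K1\<close> and of \<open>p\<close>, which keeps the quotients and square roots smooth.\<close>

section \<open>Calculus within a parameter interval\<close>

lemma D_eqI:
  assumes "is_interval I" "interior I \<noteq> {}" "s \<in> I"
    and "(f has_vector_derivative d) (at s within I)"
  shows "D I f s = d"
proof -
  have "I \<noteq> {x}" for x
    using assms(2) by auto
  then have "s islimpt I"
    using assms by (intro connected_imp_perfect) (auto simp: is_interval_connected)
  then have "at s within I \<noteq> bot"
    by (simp add: trivial_limit_within)
  then show ?thesis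
    using assms(4) by (simp add: D_def vector_derivative_within)
qed

lemma differentiable_D:
  "f differentiable (at s within I) \<Longrightarrow> (f has_vector_derivative D I f s) (at s within I)"
  by (simp add: D_def vector_derivative_works)

text \<open>Closure of smoothness under an operation is proved by induction on the order of
  differentiability: the derivative of the result is an expression in the operation itself,
  in operations treated before, and in functions that are one order less differentiable.\<close>

definition times_differentiable :: "nat \<Rightarrow> real set \<Rightarrow> (real \<Rightarrow> 'a::real_normed_vector) \<Rightarrow> bool" where
  "times_differentiable n I f \<longleftrightarrow> (\<forall>k<n. \<forall>s\<in>I. (D I ^^ k) f differentiable (at s within I))"

lemma smooth_in_iff_times_differentiable: "smooth_in I f \<longleftrightarrow> (\<forall>n. times_differentiable n I f)"
  by (auto simp: smooth_in_def times_differentiable_def)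

lemma times_differentiable_0: "times_differentiable 0 I f"
  by (simp add: times_differentiable_def)

lemma times_differentiable_mono: "times_differentiable (Suc n) I f \<Longrightarrow> times_differentiable n I f"
  by (simp add: times_differentiable_def)

lemma times_differentiable_Suc:
  "times_differentiable (Suc n) I f \<longleftrightarrow>
     (\<forall>s\<in>I. (f has_vector_derivative D I f s) (at s within I)) \<and> times_differentiable n I (D I f)"
  unfolding times_differentiable_def All_less_Suc2 funpow_swap1[symmetric]
  by (auto simp: differentiable_D funpow_swap1 intro: differentiableI_vector)

lemma D_cong:
  assumes "\<And>s. s \<in> I \<Longrightarrow> f s = g s" "s \<in> I"
  shows "D I f s = D I g s"
proof -
  have "(f has_vector_derivative d) (at s within I) \<longleftrightarrow> (g has_vector_derivative d) (at s within I)" for d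
    using has_vector_derivative_transform[of s I f g d] has_vector_derivative_transform[of s I g f d] assms
    by auto
  then show ?thesis
    by (simp add: D_def vector_derivative_def)
qed

text \<open>Derivatives within \<open>I\<close> do not see values outside \<open>I\<close>.  This allows a function to be replaced
  by a formula that is valid on \<open>I\<close> only, such as a frame equation.\<close>

lemma times_differentiable_cong:
  assumes "\<And>s. s \<in> I \<Longrightarrow> f s = g s" "times_differentiable n I f"
  shows "times_differentiable n I g"
  using assms
proof (induction n arbitrary: f g)
  case 0
  then show ?case by (simp add: times_differentiable_0)
next
  case (Suc n)
  have D: "D I f s = D I g s" if "s \<in> I" for s
    using Suc.prems(1) that by (rule D_cong)
  have "(g has_vector_derivative D I g s) (at s within I)" if "s \<in> I" for s
  proof -
    have "(f has_vector_derivative D I g s) (at s within I)"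
      using Suc.prems(2) that unfolding times_differentiable_Suc D[OF that, symmetric] by blast
    then show ?thesis
      using has_vector_derivative_transform[of s I g f] that Suc.prems(1) by simp
  qed
  moreover have "times_differentiable n I (D I g)"
    using D Suc.prems(2) by (intro Suc.IH[of "D I f" "D I g"]) (auto simp: times_differentiable_Suc)
  ultimately show ?case by (simp add: times_differentiable_Suc)
qed

lemma smooth_in_cong: "smooth_in I f \<Longrightarrow> (\<And>s. s \<in> I \<Longrightarrow> f s = g s) \<Longrightarrow> smooth_in I g"
  using times_differentiable_cong[of I f g] by (simp add: smooth_in_iff_times_differentiable)

lemma smooth_in_has_derivative:
  "smooth_in I f \<Longrightarrow> s \<in> I \<Longrightarrow> (f has_vector_derivative D I f s) (at s within I)"
  using times_differentiable_Suc[of 0 I f] by (simp add: smooth_in_iff_times_differentiable)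

lemma smooth_in_D: "smooth_in I f \<Longrightarrow> smooth_in I (D I f)"
proof -
  assume "smooth_in I f"
  then have "times_differentiable (Suc n) I f" for n
    by (simp add: smooth_in_iff_times_differentiable)
  then show ?thesis
    by (simp add: smooth_in_iff_times_differentiable times_differentiable_Suc)
qed

text \<open>An interval with interior points has no isolated points, so derivatives within it are
  unique, also at its end points.\<close>

locale parameter_interval =
  fixes I :: "real set"
  assumes interval: "is_interval I" and nondegenerate: "interior I \<noteq> {}"
begin

lemmas D_eq = D_eqI[OF interval nondegenerate]

lemma times_differentiable_SucI:
  assumes "\<And>s. s \<in> I \<Longrightarrow> (f has_vector_derivative f' s) (at s within I)"
    and "times_differentiable n I f'"
  shows "times_differentiable (Suc n) I f"
proof -
  have "D I f s = f' s" if "s \<in> I" for s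
    using that assms(1) by (simp add: D_eq)
  then have "times_differentiable n I (D I f)"
    by (intro times_differentiable_cong[OF _ assms(2)]) simp
  moreover have "(f has_vector_derivative D I f s) (at s within I)" if "s \<in> I" for s
    using assms(1)[OF that] D_eq[OF that assms(1)[OF that]] by simp
  ultimately show ?thesis
    by (simp add: times_differentiable_Suc)
qed

lemma times_differentiable_const: "times_differentiable n I (\<lambda>_. c)"
proof (induction n arbitrary: c)
  case (Suc n)
  show ?case by (rule times_differentiable_SucI[of _ "\<lambda>_. 0"]) (auto simp: Suc)
qed (simp add: times_differentiable_0)

lemma times_differentiable_add:
  "times_differentiable n I f \<Longrightarrow> times_differentiable n I g \<Longrightarrow>
     times_differentiable n I (\<lambda>s. f s + g s)"
proof (induction n arbitrary: f g)
  case (Suc n)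
  show ?case
    by (rule times_differentiable_SucI[of _ "\<lambda>s. D I f s + D I g s"])
      (use Suc in \<open>auto simp: times_differentiable_Suc intro: has_vector_derivative_add\<close>)
qed (simp add: times_differentiable_0)

text \<open>One product rule serves for products of reals, scalar multiples, inner products and cross
  products.\<close>

lemma times_differentiable_bilinear:
  assumes "bounded_bilinear h"
  shows "times_differentiable n I f \<Longrightarrow> times_differentiable n I g \<Longrightarrow>
     times_differentiable n I (\<lambda>s. h (f s) (g s))"
proof (induction n arbitrary: f g)
  case (Suc n)
  show ?case
  proof (rule times_differentiable_SucI[of _ "\<lambda>s. h (f s) (D I g s) + h (D I f s) (g s)"])
    show "((\<lambda>s. h (f s) (g s)) has_vector_derivative h (f s) (D I g s) + h (D I f s) (g s)) (at s within I)"
      if "s \<in> I" for s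
      using Suc.prems that
      by (intro bounded_bilinear.has_vector_derivative[OF assms]) (auto simp: times_differentiable_Suc)
    show "times_differentiable n I (\<lambda>s. h (f s) (D I g s) + h (D I f s) (g s))"
      using Suc.prems times_differentiable_mono[OF Suc.prems(1)] times_differentiable_mono[OF Suc.prems(2)]
      by (intro times_differentiable_add Suc.IH) (auto simp: times_differentiable_Suc)
  qed
qed (simp add: times_differentiable_0)

lemma times_differentiable_inverse:
  fixes f :: "real \<Rightarrow> real"
  assumes "\<And>s. s \<in> I \<Longrightarrow> f s \<noteq> 0"
  shows "times_differentiable n I f \<Longrightarrow> times_differentiable n I (\<lambda>s. inverse (f s))"
proof (induction n)
  case (Suc n)
  show ?case
  proof (rule times_differentiable_SucI[of _ "\<lambda>s. (- 1) * ((inverse (f s) * D I f s) * inverse (f s))"])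
    fix s assume "s \<in> I"
    then have "(f has_real_derivative D I f s) (at s within I)"
      using Suc.prems by (simp add: times_differentiable_Suc has_real_derivative_iff_has_vector_derivative)
    then show "((\<lambda>s. inverse (f s)) has_vector_derivative
        (- 1) * ((inverse (f s) * D I f s) * inverse (f s))) (at s within I)"
      unfolding has_real_derivative_iff_has_vector_derivative[symmetric]
      by (auto intro!: derivative_eq_intros simp: assms[OF \<open>s \<in> I\<close>])
  next
    show "times_differentiable n I (\<lambda>s. (- 1) * ((inverse (f s) * D I f s) * inverse (f s)))"
      using Suc.IH[OF times_differentiable_mono[OF Suc.prems]] Suc.prems
      by (intro times_differentiable_bilinear[OF bounded_bilinear_mult] times_differentiable_const)
        (auto simp: times_differentiable_Suc)
  qed
qed (simp add: times_differentiable_0)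

lemma times_differentiable_sqrt:
  assumes "\<And>s. s \<in> I \<Longrightarrow> f s > 0"
  shows "times_differentiable n I f \<Longrightarrow> times_differentiable n I (\<lambda>s. sqrt (f s))"
proof (induction n)
  case (Suc n)
  show ?case
  proof (rule times_differentiable_SucI[of _ "\<lambda>s. (inverse (sqrt (f s)) * D I f s) * (1 / 2)"])
    fix s assume "s \<in> I"
    then have "(f has_real_derivative D I f s) (at s within I)"
      using Suc.prems by (simp add: times_differentiable_Suc has_real_derivative_iff_has_vector_derivative)
    then show "((\<lambda>s. sqrt (f s)) has_vector_derivative
        (inverse (sqrt (f s)) * D I f s) * (1 / 2)) (at s within I)"
      unfolding has_real_derivative_iff_has_vector_derivative[symmetric]
      using assms[OF \<open>s \<in> I\<close>] by (auto intro!: derivative_eq_intros)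
  next
    have "sqrt (f s) \<noteq> 0" if "s \<in> I" for s
      using assms[OF that] by simp
    then have "times_differentiable n I (\<lambda>s. inverse (sqrt (f s)))"
      using Suc.IH[OF times_differentiable_mono[OF Suc.prems]] by (rule times_differentiable_inverse)
    then show "times_differentiable n I (\<lambda>s. (inverse (sqrt (f s)) * D I f s) * (1 / 2))"
      using Suc.prems
      by (intro times_differentiable_bilinear[OF bounded_bilinear_mult] times_differentiable_const)
        (auto simp: times_differentiable_Suc)
  qed
qed (simp add: times_differentiable_0)

lemma smooth_in_add: "smooth_in I f \<Longrightarrow> smooth_in I g \<Longrightarrow> smooth_in I (\<lambda>s. f s + g s)"
  by (simp add: smooth_in_iff_times_differentiable times_differentiable_add)

lemma smooth_in_bilinear:
  "bounded_bilinear h \<Longrightarrow> smooth_in I f \<Longrightarrow> smooth_in I g \<Longrightarrow> smooth_in I (\<lambda>s. h (f s) (g s))"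
  using times_differentiable_bilinear[of h _ f g] by (simp add: smooth_in_iff_times_differentiable)

lemmas smooth_in_mult = smooth_in_bilinear[OF bounded_bilinear_mult]
lemmas smooth_in_scaleR = smooth_in_bilinear[OF bounded_bilinear_scaleR]
lemmas smooth_in_inner = smooth_in_bilinear[OF bounded_bilinear_inner]
lemmas smooth_in_cross3 = smooth_in_bilinear[OF bilinear_cross[unfolded bilinear_conv_bounded_bilinear]]

lemma smooth_in_inverse:
  fixes f :: "real \<Rightarrow> real"
  shows "smooth_in I f \<Longrightarrow> (\<And>s. s \<in> I \<Longrightarrow> f s \<noteq> 0) \<Longrightarrow> smooth_in I (\<lambda>s. inverse (f s))"
  by (simp add: smooth_in_iff_times_differentiable times_differentiable_inverse)

lemma smooth_in_sqrt: "smooth_in I f \<Longrightarrow> (\<And>s. s \<in> I \<Longrightarrow> f s > 0) \<Longrightarrow> smooth_in I (\<lambda>s. sqrt (f s))"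
  by (simp add: smooth_in_iff_times_differentiable times_differentiable_sqrt)

lemma smooth_in_norm:
  fixes f :: "real \<Rightarrow> 'a::real_inner"
  assumes "smooth_in I f" "\<And>s. s \<in> I \<Longrightarrow> f s \<noteq> 0"
  shows "smooth_in I (\<lambda>s. norm (f s))"
  unfolding norm_eq_sqrt_inner using assms by (intro smooth_in_sqrt smooth_in_inner) auto

text \<open>Most frame equations are read off by differentiating a known inner product, in particular
  one of the orthonormality relations.\<close>

lemma derivative_inner_eq:
  assumes "\<And>t. t \<in> I \<Longrightarrow> f t \<bullet> g t = c t" "s \<in> I"
    and "(f has_vector_derivative f') (at s within I)"
    and "(g has_vector_derivative g') (at s within I)"
    and "(c has_vector_derivative c') (at s within I)"
  shows "f s \<bullet> g' + f' \<bullet> g s = c'"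
proof -
  have "((\<lambda>t. f t \<bullet> g t) has_vector_derivative f s \<bullet> g' + f' \<bullet> g s) (at s within I)"
    using assms(3,4) by (rule bounded_bilinear.has_vector_derivative[OF bounded_bilinear_inner])
  then have "D I (\<lambda>t. f t \<bullet> g t) s = f s \<bullet> g' + f' \<bullet> g s"
    by (rule D_eq[OF assms(2)])
  moreover have "D I (\<lambda>t. f t \<bullet> g t) s = D I c s"
    using assms(1,2) by (rule D_cong)
  ultimately show ?thesis
    using D_eq[OF assms(2,5)] by simp
qed

lemmas derivative_inner_const_eq = derivative_inner_eq[where c' = 0, OF _ _ _ _ has_vector_derivative_const]

lemma constant_on_if_derivative_zero:
  assumes "\<And>s. s \<in> I \<Longrightarrow> (f has_vector_derivative 0) (at s within I)"
  obtains c where "\<And>s. s \<in> I \<Longrightarrow> f s = c"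
proof -
  have "convex I"
    using interval by (rule is_interval_convex)
  then show ?thesis
    using has_vector_derivative_zero_constant[of I f] assms that by metis
qed

end

section \<open>Constant angles and orthonormal frames\<close>

text \<open>The function \<open>arccos\<close> is injective on \<open>[- 1, 1]\<close>, where the inner products of unit vectors
  lie.\<close>

lemma makes_constant_angle_iff_inner:
  assumes "\<And>s. s \<in> I \<Longrightarrow> norm (X s) = 1"
  shows "makes_constant_angle I X \<longleftrightarrow> (\<exists>u. norm u = 1 \<and> (\<exists>c. \<forall>s\<in>I. X s \<bullet> u = c))"
proof -
  have "(\<lambda>s. vec_angle (X s) u) constant_on I \<longleftrightarrow> (\<exists>c. \<forall>s\<in>I. X s \<bullet> u = c)" if u: "norm u = 1" for u
  proof -
    have "\<bar>X s \<bullet> u\<bar> \<le> 1" if "s \<in> I" for s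
      using Cauchy_Schwarz_ineq2[of "X s" u] assms[OF that] u by simp
    then have eq: "arccos (X s \<bullet> u) = arccos (X t \<bullet> u) \<longleftrightarrow> X s \<bullet> u = X t \<bullet> u"
      if "s \<in> I" "t \<in> I" for s t
      using that by (simp add: arccos_eq_iff)
    have angle: "vec_angle (X s) u = arccos (X s \<bullet> u)" if "s \<in> I" for s
      using assms[OF that] u by (simp add: vec_angle_def)
    show ?thesis
      unfolding constant_on_def using eq angle by metis
  qed
  then show ?thesis
    unfolding makes_constant_angle_def by blast
qed

lemma cross3_orthonormal:
  assumes "x \<bullet> x = 1" "y \<bullet> y = 1" "x \<bullet> y = 0"
  shows "cross3 x y \<bullet> cross3 x y = 1" "cross3 x y \<bullet> x = 0" "cross3 x y \<bullet> y = 0"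
    "cross3 x (cross3 x y) = - y" "cross3 y (cross3 x y) = x"
  using assms norm_cross[of x y]
  by (auto simp: Lagrange dot_cross_self power2_norm_eq_inner inner_commute)

text \<open>The difference \<open>w\<close> of the two sides is orthogonal to \<open>x\<close>, \<open>y\<close> and \<open>x \<times> y\<close>.  The first two
  relations give \<open>w \<times> (x \<times> y) = 0\<close> by the triple product formula, so that \<open>w\<close> is parallel to the
  unit vector \<open>x \<times> y\<close>, to which it is also orthogonal.\<close>

lemma orthonormal_expansion:
  fixes x y v :: "real^3"
  assumes "x \<bullet> x = 1" "y \<bullet> y = 1" "x \<bullet> y = 0"
  shows "v = (v \<bullet> x) *\<^sub>R x + (v \<bullet> y) *\<^sub>R y + (v \<bullet> cross3 x y) *\<^sub>R cross3 x y"
proof -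
  note z = cross3_orthonormal[OF assms]
  define w where "w = v - ((v \<bullet> x) *\<^sub>R x + (v \<bullet> y) *\<^sub>R y + (v \<bullet> cross3 x y) *\<^sub>R cross3 x y)"
  have w: "w \<bullet> x = 0" "w \<bullet> y = 0" "w \<bullet> cross3 x y = 0"
    using assms z by (auto simp: w_def inner_simps inner_commute)
  have "cross3 w (cross3 x y) = 0"
    using w by (simp add: Lagrange)
  then have "w = 0"
    using norm_cross_dot[of w "cross3 x y"] w z(1) by (auto simp: norm_eq_1[symmetric])
  then show ?thesis by (simp add: w_def)
qed

section \<open>Frames that satisfy the alternative frame equations\<close>

text \<open>The equivalences depend only on the frame equations, whatever the curve and the versor
  field from which the frame arises.\<close>

locale alternative_frame = parameter_interval +
  fixes X Y W :: "real \<Rightarrow> real^3" and p q :: "real \<Rightarrow> real"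
  assumes orthonormal: "\<And>s. s \<in> I \<Longrightarrow> X s \<bullet> X s = 1" "\<And>s. s \<in> I \<Longrightarrow> Y s \<bullet> Y s = 1"
      "\<And>s. s \<in> I \<Longrightarrow> X s \<bullet> Y s = 0"
    and binormal: "\<And>s. s \<in> I \<Longrightarrow> W s = cross3 (X s) (Y s)"
    and derivative_X: "\<And>s. s \<in> I \<Longrightarrow> (X has_vector_derivative p s *\<^sub>R Y s) (at s within I)"
    and derivative_Y: "\<And>s. s \<in> I \<Longrightarrow>
      (Y has_vector_derivative q s *\<^sub>R W s - p s *\<^sub>R X s) (at s within I)"
    and smooth_p: "smooth_in I p" and smooth_q: "smooth_in I q"
    and p_nonzero: "\<And>s. s \<in> I \<Longrightarrow> p s \<noteq> 0" and q_nonzero: "\<And>s. s \<in> I \<Longrightarrow> q s \<noteq> 0"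
begin

lemma W_orthonormal:
  assumes "s \<in> I"
  shows "W s \<bullet> W s = 1" "W s \<bullet> X s = 0" "W s \<bullet> Y s = 0"
  using cross3_orthonormal[of "X s" "Y s"] assms by (auto simp: orthonormal binormal)

lemma derivative_W:
  assumes s: "s \<in> I"
  shows "(W has_vector_derivative - q s *\<^sub>R Y s) (at s within I)"
proof -
  have "((\<lambda>t. cross3 (X t) (Y t)) has_vector_derivative
      cross3 (X s) (q s *\<^sub>R W s - p s *\<^sub>R X s) + cross3 (p s *\<^sub>R Y s) (Y s)) (at s within I)"
    using s by (intro bounded_bilinear.has_vector_derivative derivative_X derivative_Y)
      (auto simp: bilinear_conv_bounded_bilinear[symmetric] bilinear_cross)
  also have "cross3 (X s) (q s *\<^sub>R W s - p s *\<^sub>R X s) + cross3 (p s *\<^sub>R Y s) (Y s) = - q s *\<^sub>R Y s"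
    using cross3_orthonormal(4)[of "X s" "Y s"] s
    by (simp add: Cross3.right_diff_distrib cross_mult_left cross_mult_right binormal orthonormal)
  finally show ?thesis
    using s binormal by (auto intro: has_vector_derivative_transform)
qed

lemmas has_derivative_p = smooth_in_has_derivative[OF smooth_p]
lemmas has_derivative_q = smooth_in_has_derivative[OF smooth_q]
lemmas has_derivative_Dp = smooth_in_has_derivative[OF smooth_in_D[OF smooth_p]]

text \<open>The derivative of \<open>X \<bullet> u\<close> is \<open>p (Y \<bullet> u)\<close>, and \<open>p\<close> has no zero.\<close>

lemma X_inner_const_iff:
  "(\<exists>c. \<forall>s\<in>I. X s \<bullet> u = c) \<longleftrightarrow> (\<forall>s\<in>I. Y s \<bullet> u = 0)"
proof
  assume "\<exists>c. \<forall>s\<in>I. X s \<bullet> u = c"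
  then obtain c where "\<And>s. s \<in> I \<Longrightarrow> X s \<bullet> u = c" by blast
  from derivative_inner_const_eq[OF this _ derivative_X has_vector_derivative_const]
  show "\<forall>s\<in>I. Y s \<bullet> u = 0"
    using p_nonzero by auto
next
  assume *: "\<forall>s\<in>I. Y s \<bullet> u = 0"
  have "((\<lambda>s. X s \<bullet> u) has_vector_derivative 0) (at s within I)" if "s \<in> I" for s
    using bounded_linear.has_vector_derivative[OF bounded_linear_inner_left derivative_X[OF that], of u] * that
    by simp
  then show "\<exists>c. \<forall>s\<in>I. X s \<bullet> u = c"
    by (rule constant_on_if_derivative_zero) blast+
qed

lemma W_inner_const_iff:
  "(\<exists>c. \<forall>s\<in>I. W s \<bullet> u = c) \<longleftrightarrow> (\<forall>s\<in>I. Y s \<bullet> u = 0)"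
proof
  assume "\<exists>c. \<forall>s\<in>I. W s \<bullet> u = c"
  then obtain c where "\<And>s. s \<in> I \<Longrightarrow> W s \<bullet> u = c" by blast
  from derivative_inner_const_eq[OF this _ derivative_W has_vector_derivative_const]
  show "\<forall>s\<in>I. Y s \<bullet> u = 0"
    using q_nonzero by auto
next
  assume *: "\<forall>s\<in>I. Y s \<bullet> u = 0"
  have "((\<lambda>s. W s \<bullet> u) has_vector_derivative 0) (at s within I)" if "s \<in> I" for s
    using bounded_linear.has_vector_derivative[OF bounded_linear_inner_left derivative_W[OF that], of u] * that
    by simp
  then show "\<exists>c. \<forall>s\<in>I. W s \<bullet> u = c"
    by (rule constant_on_if_derivative_zero) blast+
qed

lemma constant_angle_X_iff:
  "makes_constant_angle I X \<longleftrightarrow> (\<exists>u. norm u = 1 \<and> (\<forall>s\<in>I. Y s \<bullet> u = 0))"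
  using orthonormal(1) by (simp add: makes_constant_angle_iff_inner norm_eq_1 X_inner_const_iff)

lemma constant_angle_W_iff:
  "makes_constant_angle I W \<longleftrightarrow> (\<exists>u. norm u = 1 \<and> (\<forall>s\<in>I. Y s \<bullet> u = 0))"
  using W_orthonormal(1) by (simp add: makes_constant_angle_iff_inner norm_eq_1 W_inner_const_iff)

text \<open>The right-hand side says that \<open>q / p\<close> has derivative zero.\<close>

lemma fixed_normal_iff_proportional:
  "(\<exists>u. norm u = 1 \<and> (\<forall>s\<in>I. Y s \<bullet> u = 0)) \<longleftrightarrow> (\<forall>s\<in>I. p s * D I q s = q s * D I p s)"
proof
  assume "\<exists>u. norm u = 1 \<and> (\<forall>s\<in>I. Y s \<bullet> u = 0)"
  then obtain u where u: "norm u = 1" and Y: "\<And>s. s \<in> I \<Longrightarrow> Y s \<bullet> u = 0" by blast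
  obtain a where a: "\<And>s. s \<in> I \<Longrightarrow> X s \<bullet> u = a" using X_inner_const_iff Y by metis
  obtain b where b: "\<And>s. s \<in> I \<Longrightarrow> W s \<bullet> u = b" using W_inner_const_iff Y by metis
  have pa: "p s * a = q s * b" if "s \<in> I" for s
    using derivative_inner_const_eq[OF Y that derivative_Y[OF that] has_vector_derivative_const]
      a[OF that] b[OF that] by (simp add: inner_simps)
  \<comment> \<open>Differentiating \<open>p a = q b\<close> gives \<open>p' a = q' b\<close>; the two relations eliminate \<open>b\<close>.\<close>
  show "\<forall>s\<in>I. p s * D I q s = q s * D I p s"
  proof
    fix s assume s: "s \<in> I"
    have "a \<noteq> 0"
    proof
      assume "a = 0"
      then have "b = 0" using pa[OF s] q_nonzero[OF s] by simp
      have "u = 0"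
        using orthonormal_expansion[of "X s" "Y s" u] orthonormal[OF s] a[OF s] b[OF s] Y[OF s]
          \<open>a = 0\<close> \<open>b = 0\<close> binormal[OF s] by (simp add: inner_commute)
      then show False using u by simp
    qed
    have "D I (\<lambda>t. p t * a) s = D I (\<lambda>t. q t * b) s"
      using pa s by (rule D_cong)
    moreover have "D I (\<lambda>t. p t * a) s = D I p s * a"
      by (intro D_eq[OF s] has_vector_derivative_mult_left has_derivative_p[OF s])
    moreover have "D I (\<lambda>t. q t * b) s = D I q s * b"
      by (intro D_eq[OF s] has_vector_derivative_mult_left has_derivative_q[OF s])
    ultimately have "D I p s * a = D I q s * b"
      by simp
    then have "(p s * D I q s) * a = (q s * D I p s) * a"
      using pa[OF s] by algebra
    then show "p s * D I q s = q s * D I p s"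
      using \<open>a \<noteq> 0\<close> by simp
  qed
next
  assume eq: "\<forall>s\<in>I. p s * D I q s = q s * D I p s"
  \<comment> \<open>By the relation \<open>p (X \<bullet> u) = q (W \<bullet> u)\<close>, a fixed normal of \<open>Y\<close> is a multiple of \<open>q X + p W\<close>.
    Scaling the component along \<open>W\<close> to 1 makes it constant.\<close>
  define v where "v s = (q s / p s) *\<^sub>R X s + W s" for s
  have "(v has_vector_derivative 0) (at s within I)" if s: "s \<in> I" for s
  proof -
    have "((\<lambda>s. q s / p s) has_real_derivative (D I q s * p s - q s * D I p s) / (p s * p s)) (at s within I)"
      using has_derivative_p[OF s] has_derivative_q[OF s] p_nonzero[OF s]
      by (intro DERIV_divide) (auto simp: has_real_derivative_iff_has_vector_derivative)
    then have quotient: "((\<lambda>s. q s / p s) has_real_derivative 0) (at s within I)"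
      using eq s by (simp add: mult.commute)
    have "(v has_vector_derivative
        ((q s / p s) *\<^sub>R p s *\<^sub>R Y s + 0 *\<^sub>R X s) + - q s *\<^sub>R Y s) (at s within I)"
      unfolding v_def
      by (intro has_vector_derivative_add has_vector_derivative_scaleR quotient derivative_X derivative_W s)
    then show ?thesis
      using p_nonzero[OF s] by simp
  qed
  then obtain v0 where v0: "\<And>s. s \<in> I \<Longrightarrow> v s = v0"
    using constant_on_if_derivative_zero[of v] by metis
  obtain t where t: "t \<in> I"
    using nondegenerate interior_subset by blast
  have "W t \<bullet> v0 = 1"
    using W_orthonormal[OF t] by (simp add: v0[OF t, symmetric] v_def inner_simps)
  then have "v0 \<noteq> 0" by auto
  have "Y s \<bullet> v0 = 0" if s: "s \<in> I" for s
    using W_orthonormal[OF s] orthonormal[OF s]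
    by (simp add: v0[OF s, symmetric] v_def inner_simps inner_commute)
  then show "\<exists>u. norm u = 1 \<and> (\<forall>s\<in>I. Y s \<bullet> u = 0)"
    using \<open>v0 \<noteq> 0\<close> by (intro exI[of _ "v0 /\<^sub>R norm v0"]) simp
qed

lemma D_X: "s \<in> I \<Longrightarrow> D I X s = p s *\<^sub>R Y s"
  using D_eq derivative_X by blast

lemma D2_X:
  assumes s: "s \<in> I"
  shows "D I (D I X) s = D I p s *\<^sub>R Y s + p s *\<^sub>R (q s *\<^sub>R W s - p s *\<^sub>R X s)"
proof -
  have "D I (D I X) s = D I (\<lambda>t. p t *\<^sub>R Y t) s"
    using D_X s by (rule D_cong)
  also have "\<dots> = p s *\<^sub>R (q s *\<^sub>R W s - p s *\<^sub>R X s) + D I p s *\<^sub>R Y s"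
    by (intro D_eq bounded_bilinear.has_vector_derivative[OF bounded_bilinear_scaleR]
        derivative_Y has_derivative_p s)
  finally show ?thesis by simp
qed

lemma D3_X:
  assumes s: "s \<in> I"
  shows "D I (D I (D I X)) s =
    (D I (D I p) s - p s * ((p s)\<^sup>2 + (q s)\<^sup>2)) *\<^sub>R Y s
    + (2 * D I p s * q s + p s * D I q s) *\<^sub>R W s - (3 * p s * D I p s) *\<^sub>R X s"
proof -
  have "D I (D I (D I X)) s =
      D I (\<lambda>t. D I p t *\<^sub>R Y t + p t *\<^sub>R (q t *\<^sub>R W t - p t *\<^sub>R X t)) s"
    using D2_X s by (rule D_cong)
  also have "\<dots> =
      (D I p s *\<^sub>R (q s *\<^sub>R W s - p s *\<^sub>R X s) + D I (D I p) s *\<^sub>R Y s)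
      + (p s *\<^sub>R ((q s *\<^sub>R (- q s *\<^sub>R Y s) + D I q s *\<^sub>R W s) - (p s *\<^sub>R (p s *\<^sub>R Y s) + D I p s *\<^sub>R X s))
         + D I p s *\<^sub>R (q s *\<^sub>R W s - p s *\<^sub>R X s))"
    by (intro D_eq has_vector_derivative_add has_vector_derivative_diff
        bounded_bilinear.has_vector_derivative[OF bounded_bilinear_scaleR]
        derivative_X derivative_Y derivative_W has_derivative_p has_derivative_q has_derivative_Dp s)
  also have "\<dots> = (D I (D I p) s - p s * ((p s)\<^sup>2 + (q s)\<^sup>2)) *\<^sub>R Y s
    + (2 * D I p s * q s + p s * D I q s) *\<^sub>R W s - (3 * p s * D I p s) *\<^sub>R X s"
    by (simp add: vec_eq_iff algebra_simps power2_eq_square)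
  finally show ?thesis .
qed

lemma D_pq: "s \<in> I \<Longrightarrow> D I (\<lambda>t. p t * q t) s = p s * D I q s + D I p s * q s"
  by (intro D_eq has_vector_derivative_mult has_derivative_p has_derivative_q)

lemma D_inverse_p:
  assumes s: "s \<in> I"
  shows "D I (\<lambda>u. 1 / p u) s = - D I p s / (p s)\<^sup>2"
proof (rule D_eq[OF s])
  have "((\<lambda>u. 1 / p u) has_real_derivative - D I p s / (p s)\<^sup>2) (at s within I)"
    using has_derivative_p[OF s] p_nonzero[OF s]
    by (auto intro!: derivative_eq_intros
        simp: has_real_derivative_iff_has_vector_derivative[symmetric] power2_eq_square)
  then show "((\<lambda>u. 1 / p u) has_vector_derivative - D I p s / (p s)\<^sup>2) (at s within I)"
    by (simp add: has_real_derivative_iff_has_vector_derivative)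
qed

lemma D_inverse_p_over_q:
  assumes s: "s \<in> I"
  shows "D I (\<lambda>t. D I (\<lambda>u. 1 / p u) t * (1 / q t)) s =
    D I p s * (2 * p s * D I p s * q s + (p s)\<^sup>2 * D I q s) / ((p s)\<^sup>2 * q s)\<^sup>2
    - D I (D I p) s / ((p s)\<^sup>2 * q s)"
    (is "_ = ?d")
proof -
  have "D I (\<lambda>t. D I (\<lambda>u. 1 / p u) t * (1 / q t)) s = D I (\<lambda>t. - D I p t / (p t)\<^sup>2 * (1 / q t)) s"
    using s by (intro D_cong) (simp_all add: D_inverse_p)
  also have "\<dots> = ?d"
  proof (rule D_eq[OF s])
    have "((\<lambda>t. - D I p t / (p t)\<^sup>2 * (1 / q t)) has_real_derivative ?d) (at s within I)"
      using has_derivative_p[OF s] has_derivative_q[OF s] has_derivative_Dp[OF s]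
        p_nonzero[OF s] q_nonzero[OF s]
      unfolding has_real_derivative_iff_has_vector_derivative[symmetric]
      by (auto intro!: derivative_eq_intros simp: field_simps power2_eq_square)
    then show "((\<lambda>t. - D I p t / (p t)\<^sup>2 * (1 / q t)) has_vector_derivative ?d) (at s within I)"
      by (simp add: has_real_derivative_iff_has_vector_derivative)
  qed
  finally show ?thesis .
qed

text \<open>The coefficient \<open>A\<close> of the second derivative is the one that cancels the component along \<open>W\<close>,
  and then \<open>B\<close> is the one that cancels the component along \<open>Y\<close>.  The component along \<open>X\<close> cannot be
  adjusted any more; it is the obstruction to the constancy of \<open>q / p\<close>.\<close>

lemma differential_expression_eq:
  assumes s: "s \<in> I"
  shows "D I (D I (D I X)) s
    - (D I p s / p s + D I (\<lambda>t. p t * q t) s / (p s * q s)) *\<^sub>R D I (D I X) s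
    + (p s * q s * D I (\<lambda>t. D I (\<lambda>u. 1 / p u) t * (1 / q t)) s + (p s)\<^sup>2 + (q s)\<^sup>2) *\<^sub>R D I X s
    = (p s / q s * (p s * D I q s - q s * D I p s)) *\<^sub>R X s"
proof -
  define A where "A = D I p s / p s + D I (\<lambda>t. p t * q t) s / (p s * q s)"
  define B where "B = p s * q s * D I (\<lambda>t. D I (\<lambda>u. 1 / p u) t * (1 / q t)) s + (p s)\<^sup>2 + (q s)\<^sup>2"
  note nz = p_nonzero[OF s] q_nonzero[OF s]
  have A: "A = 2 * D I p s / p s + D I q s / q s"
    using nz by (simp add: A_def D_pq[OF s] field_simps)
  have "D I (D I (D I X)) s - A *\<^sub>R D I (D I X) s + B *\<^sub>R D I X s =
      (A * (p s)\<^sup>2 - 3 * p s * D I p s) *\<^sub>R X s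
      + (D I (D I p) s - p s * ((p s)\<^sup>2 + (q s)\<^sup>2) - A * D I p s + B * p s) *\<^sub>R Y s
      + (2 * D I p s * q s + p s * D I q s - A * p s * q s) *\<^sub>R W s"
    unfolding D_X[OF s] D2_X[OF s] D3_X[OF s]
    by (simp add: algebra_simps power2_eq_square)
  also have "A * (p s)\<^sup>2 - 3 * p s * D I p s = p s / q s * (p s * D I q s - q s * D I p s)"
    using nz by (simp add: A field_simps power2_eq_square)
  also have "D I (D I p) s - p s * ((p s)\<^sup>2 + (q s)\<^sup>2) - A * D I p s + B * p s = 0"
    using nz unfolding A B_def D_inverse_p_over_q[OF s] by (simp add: field_simps power2_eq_square)
  also have "2 * D I p s * q s + p s * D I q s - A * p s * q s = 0"
    using nz by (simp add: A field_simps)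
  finally show ?thesis
    by (simp add: A_def B_def)
qed

theorem constant_angle_iff_differential_equation:
  "makes_constant_angle I X \<longleftrightarrow>
    (\<forall>s\<in>I. D I (D I (D I X)) s
      - (D I p s / p s + D I (\<lambda>t. p t * q t) s / (p s * q s)) *\<^sub>R D I (D I X) s
      + (p s * q s * D I (\<lambda>t. D I (\<lambda>u. 1 / p u) t * (1 / q t)) s + (p s)\<^sup>2 + (q s)\<^sup>2) *\<^sub>R D I X s = 0)"
proof -
  have "p s * D I q s = q s * D I p s \<longleftrightarrow>
      (p s / q s * (p s * D I q s - q s * D I p s)) *\<^sub>R X s = 0" if "s \<in> I" for s
    using p_nonzero[OF that] q_nonzero[OF that] orthonormal(1)[OF that] by auto
  then show ?thesis
    unfolding constant_angle_X_iff fixed_normal_iff_proportional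
    by (intro ball_cong refl) (simp only: differential_expression_eq)
qed

end

section \<open>The alternative frame of a versor field\<close>

locale curved_versor_field = parameter_interval +
  fixes \<xi> :: "real \<Rightarrow> real^3"
  assumes smooth_xi: "smooth_in I \<xi>"
    and unit_xi: "\<And>s. s \<in> I \<Longrightarrow> norm (\<xi> s) = 1"
    and K1_pos: "\<And>s. s \<in> I \<Longrightarrow> K1 I \<xi> s > 0"
begin

lemma smooth_K1: "smooth_in I (K1 I \<xi>)"
proof -
  have "D I \<xi> s \<noteq> 0" if "s \<in> I" for s
    using K1_pos[OF that] by (auto simp: K1_def)
  then show ?thesis
    unfolding K1_def[abs_def] by (intro smooth_in_norm smooth_in_D smooth_xi)
qed

lemma smooth_xi2: "smooth_in I (xi2 I \<xi>)"
  unfolding xi2_def[abs_def] using K1_pos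
  by (intro smooth_in_scaleR smooth_in_inverse smooth_K1 smooth_in_D smooth_xi) (metis less_irrefl)

lemma smooth_xi3: "smooth_in I (xi3 I \<xi>)"
  unfolding xi3_def[abs_def] by (intro smooth_in_cross3 smooth_xi smooth_xi2)

lemma smooth_K2: "smooth_in I (K2 I \<xi>)"
  unfolding K2_def[abs_def] by (intro smooth_in_inner smooth_in_D smooth_xi2 smooth_xi3)

lemma p_pos: "s \<in> I \<Longrightarrow> AF_p I \<xi> s > 0"
  using K1_pos[of s] unfolding AF_p_def by (simp add: add_pos_nonneg)

lemma p_square: "(AF_p I \<xi> s)\<^sup>2 = (K1 I \<xi> s)\<^sup>2 + (K2 I \<xi> s)\<^sup>2"
  by (simp add: AF_p_def)

lemma smooth_p: "smooth_in I (AF_p I \<xi>)"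
proof -
  have "(K1 I \<xi> s)\<^sup>2 + (K2 I \<xi> s)\<^sup>2 > 0" if "s \<in> I" for s
    using K1_pos[OF that] by (simp add: add_pos_nonneg)
  then show ?thesis
    unfolding AF_p_def[abs_def] power2_eq_square
    by (intro smooth_in_sqrt smooth_in_add smooth_in_mult smooth_K1 smooth_K2)
qed

lemma D_xi: "s \<in> I \<Longrightarrow> D I \<xi> s = K1 I \<xi> s *\<^sub>R xi2 I \<xi> s"
  using K1_pos[of s] by (simp add: xi2_def)

lemma frenet_frame_orthonormal:
  assumes s: "s \<in> I"
  shows "\<xi> s \<bullet> \<xi> s = 1" "xi2 I \<xi> s \<bullet> xi2 I \<xi> s = 1" "\<xi> s \<bullet> xi2 I \<xi> s = 0"
proof -
  have unit: "\<xi> t \<bullet> \<xi> t = 1" if "t \<in> I" for t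
    using unit_xi[OF that] by (simp add: norm_eq_1)
  then show "\<xi> s \<bullet> \<xi> s = 1" using s .
  have "norm (xi2 I \<xi> s) = 1"
    using K1_pos[OF s] by (simp add: xi2_def) (simp add: K1_def)
  then show "xi2 I \<xi> s \<bullet> xi2 I \<xi> s = 1" by (simp add: norm_eq_1)
  have "\<xi> s \<bullet> D I \<xi> s = 0"
    using derivative_inner_const_eq[OF unit s] smooth_in_has_derivative[OF smooth_xi s]
    by (force simp: inner_commute)
  then show "\<xi> s \<bullet> xi2 I \<xi> s = 0" by (simp add: xi2_def)
qed

lemma frenet_xi3:
  assumes s: "s \<in> I"
  shows "xi3 I \<xi> s \<bullet> xi3 I \<xi> s = 1" "xi3 I \<xi> s \<bullet> \<xi> s = 0" "xi3 I \<xi> s \<bullet> xi2 I \<xi> s = 0"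
    "cross3 (xi2 I \<xi> s) (xi3 I \<xi> s) = \<xi> s" "cross3 (xi2 I \<xi> s) (\<xi> s) = - xi3 I \<xi> s"
  using cross3_orthonormal[OF frenet_frame_orthonormal[OF s]]
    cross_skew[of "xi2 I \<xi> s" "\<xi> s"]
  by (simp_all add: xi3_def)

lemma D_xi2_inner:
  assumes s: "s \<in> I"
  shows "D I (xi2 I \<xi>) s \<bullet> xi2 I \<xi> s = 0" "D I (xi2 I \<xi>) s \<bullet> \<xi> s = - K1 I \<xi> s"
proof -
  note dX = smooth_in_has_derivative[OF smooth_xi2 s]
  note dE = smooth_in_has_derivative[OF smooth_xi s]
  show "D I (xi2 I \<xi>) s \<bullet> xi2 I \<xi> s = 0"
    using derivative_inner_const_eq[OF frenet_frame_orthonormal(2) s dX dX] by (simp add: inner_commute)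
  show "D I (xi2 I \<xi>) s \<bullet> \<xi> s = - K1 I \<xi> s"
    using derivative_inner_const_eq[OF frenet_frame_orthonormal(3) s dE dX]
    by (simp add: inner_commute D_xi s frenet_frame_orthonormal)
qed

lemma D_xi2:
  assumes s: "s \<in> I"
  shows "D I (xi2 I \<xi>) s = K2 I \<xi> s *\<^sub>R xi3 I \<xi> s - K1 I \<xi> s *\<^sub>R \<xi> s"
  using orthonormal_expansion[OF frenet_frame_orthonormal[OF s], of "D I (xi2 I \<xi>) s"] D_xi2_inner[OF s]
  by (simp add: K2_def xi3_def)

text \<open>This identifies the factor that normalises \<open>AF_Y\<close> with the alternative curvature \<open>p\<close>.\<close>

lemma norm_D_xi2:
  assumes s: "s \<in> I"
  shows "norm (D I (xi2 I \<xi>) s) = AF_p I \<xi> s"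
  unfolding norm_eq_sqrt_inner AF_p_def D_xi2[OF s]
  using frenet_xi3[OF s] frenet_frame_orthonormal[OF s]
  by (simp add: inner_simps inner_commute power2_eq_square algebra_simps)

lemma AF_Y_eq:
  assumes s: "s \<in> I"
  shows "AF_Y I \<xi> s = D I (xi2 I \<xi>) s /\<^sub>R AF_p I \<xi> s"
  using norm_D_xi2[OF s] by (simp add: AF_Y_def)

lemma D_xi2_eq_AF:
  assumes s: "s \<in> I"
  shows "D I (xi2 I \<xi>) s = AF_p I \<xi> s *\<^sub>R AF_Y I \<xi> s"
  using p_pos[OF s] by (simp add: AF_Y_eq[OF s])

lemma AF_orthonormal:
  assumes s: "s \<in> I"
  shows "AF_Y I \<xi> s \<bullet> AF_Y I \<xi> s = 1" "xi2 I \<xi> s \<bullet> AF_Y I \<xi> s = 0"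
proof -
  have "norm (AF_Y I \<xi> s) = 1"
    using p_pos[OF s] norm_D_xi2[OF s] by (simp add: AF_Y_def)
  then show "AF_Y I \<xi> s \<bullet> AF_Y I \<xi> s = 1" by (simp add: norm_eq_1)
  show "xi2 I \<xi> s \<bullet> AF_Y I \<xi> s = 0"
    using D_xi2_inner(1)[OF s] by (simp add: AF_Y_def inner_commute)
qed

lemma smooth_AF_Y: "smooth_in I (AF_Y I \<xi>)"
proof -
  have "smooth_in I (\<lambda>s. inverse (AF_p I \<xi> s) *\<^sub>R D I (xi2 I \<xi>) s)"
    using p_pos by (intro smooth_in_scaleR smooth_in_inverse smooth_p smooth_in_D smooth_xi2) (metis less_irrefl)
  then show ?thesis
    by (rule smooth_in_cong) (simp add: AF_Y_eq)
qed

text \<open>In the plane of \<open>\<xi>\<close> and \<open>\<xi>\<^sub>3\<close>, the cross product with \<open>\<xi>\<^sub>2\<close> is a rotation by a right angle.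
  It turns \<open>- K1 \<xi> + K2 \<xi>\<^sub>3\<close> into \<open>K2 \<xi> + K1 \<xi>\<^sub>3\<close>.\<close>

lemma AF_D_eq:
  assumes s: "s \<in> I"
  shows "AF_D I \<xi> s = (K2 I \<xi> s *\<^sub>R \<xi> s + K1 I \<xi> s *\<^sub>R xi3 I \<xi> s) /\<^sub>R AF_p I \<xi> s"
  using frenet_xi3(4,5)[OF s]
  by (simp add: AF_D_def AF_Y_eq[OF s] D_xi2[OF s] cross_mult_right Cross3.right_diff_distrib)

lemma smooth_quotient: "smooth_in I (\<lambda>t. K2 I \<xi> t / K1 I \<xi> t)"
  unfolding divide_inverse using K1_pos
  by (intro smooth_in_mult smooth_in_inverse smooth_K1 smooth_K2) (metis less_irrefl)

lemma AF_q_eq_p_square: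
  "AF_q I \<xi> s = (K1 I \<xi> s)\<^sup>2 / (AF_p I \<xi> s)\<^sup>2 * D I (\<lambda>t. K2 I \<xi> t / K1 I \<xi> t) s"
  by (simp add: AF_q_def p_square)

lemma smooth_q: "smooth_in I (AF_q I \<xi>)"
proof -
  have "smooth_in I (\<lambda>s. (K1 I \<xi> s * K1 I \<xi> s) * inverse (AF_p I \<xi> s * AF_p I \<xi> s)
      * D I (\<lambda>t. K2 I \<xi> t / K1 I \<xi> t) s)"
    by (intro smooth_in_mult smooth_in_inverse smooth_K1 smooth_p smooth_in_D smooth_quotient)
      (auto dest: p_pos)
  then show ?thesis
    by (rule smooth_in_cong)
      (simp add: AF_q_eq_p_square power2_eq_square divide_inverse)
qed

lemma AF_q_eq:
  assumes s: "s \<in> I"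
  shows "AF_q I \<xi> s =
    (K1 I \<xi> s * D I (K2 I \<xi>) s - K2 I \<xi> s * D I (K1 I \<xi>) s) / (AF_p I \<xi> s)\<^sup>2"
proof -
  have "D I (\<lambda>t. K2 I \<xi> t / K1 I \<xi> t) s =
      (D I (K2 I \<xi>) s * K1 I \<xi> s - K2 I \<xi> s * D I (K1 I \<xi>) s) / (K1 I \<xi> s * K1 I \<xi> s)"
    using smooth_in_has_derivative[OF smooth_K1 s] smooth_in_has_derivative[OF smooth_K2 s] K1_pos[OF s]
    unfolding has_real_derivative_iff_has_vector_derivative[symmetric]
    by (intro D_eq[OF s]) (simp add: DERIV_divide has_real_derivative_iff_has_vector_derivative[symmetric])
  then show ?thesis
    using K1_pos[OF s] by (simp add: AF_q_eq_p_square power2_eq_square ac_simps)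
qed

text \<open>Differentiating the components \<open>- K1\<close> and \<open>K2\<close> of \<open>\<xi>\<^sub>2'\<close> along \<open>\<xi>\<close> and \<open>\<xi>\<^sub>3\<close> gives
  \<open>\<xi>\<^sub>2'' \<bullet> \<xi> = - K1'\<close> and \<open>\<xi>\<^sub>2'' \<bullet> \<xi>\<^sub>3 = K2'\<close>: the terms from the derivatives of the frame vanish,
  since \<open>\<xi>'\<close> is parallel to \<open>\<xi>\<^sub>2\<close> and \<open>\<xi>\<^sub>3'\<close> is orthogonal to \<open>\<xi>\<close> and \<open>\<xi>\<^sub>3\<close>, while \<open>\<xi>\<^sub>2'\<close> is orthogonal
  to \<open>\<xi>\<^sub>2\<close>.\<close>

lemma D2_xi2_inner_AF_D:
  assumes s: "s \<in> I"
  shows "D I (D I (xi2 I \<xi>)) s \<bullet> AF_D I \<xi> s = AF_p I \<xi> s * AF_q I \<xi> s"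
proof -
  note dX' = smooth_in_has_derivative[OF smooth_in_D[OF smooth_xi2] s]
  note dE = smooth_in_has_derivative[OF smooth_xi s]
  note dZ = smooth_in_has_derivative[OF smooth_xi3 s]
  have E: "D I (D I (xi2 I \<xi>)) s \<bullet> \<xi> s = - D I (K1 I \<xi>) s"
    using derivative_inner_eq[OF D_xi2_inner(2) s dX' dE
        has_vector_derivative_minus[OF smooth_in_has_derivative[OF smooth_K1 s]]]
    by (simp add: D_xi s D_xi2_inner)
  have "xi3 I \<xi> s \<bullet> D I (xi3 I \<xi>) s = 0"
    using derivative_inner_const_eq[OF frenet_xi3(1) s dZ dZ] by (simp add: inner_commute)
  moreover have "\<xi> s \<bullet> D I (xi3 I \<xi>) s = 0"
    using derivative_inner_const_eq[OF frenet_xi3(2) s dZ dE] frenet_xi3(3)[OF s]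
    by (simp add: D_xi s inner_commute)
  ultimately have "D I (xi2 I \<xi>) s \<bullet> D I (xi3 I \<xi>) s = 0"
    by (simp add: D_xi2[OF s] inner_simps)
  then have Z: "D I (D I (xi2 I \<xi>)) s \<bullet> xi3 I \<xi> s = D I (K2 I \<xi>) s"
    using derivative_inner_eq[OF K2_def[symmetric] s dX' dZ smooth_in_has_derivative[OF smooth_K2 s]]
    by simp
  show ?thesis
    using p_pos[OF s] E Z
    by (simp add: AF_D_eq[OF s] AF_q_eq[OF s] inner_simps field_simps power2_eq_square)
qed

text \<open>The component along \<open>AF_D\<close> comes from \<open>\<xi>\<^sub>2'' = p Y' + p' Y\<close>, in which the second term is
  orthogonal to \<open>AF_D\<close>; the other two come from orthonormality.\<close>

lemma D_AF_Y:
  assumes s: "s \<in> I"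
  shows "D I (AF_Y I \<xi>) s = AF_q I \<xi> s *\<^sub>R AF_D I \<xi> s - AF_p I \<xi> s *\<^sub>R xi2 I \<xi> s"
proof -
  note dX = smooth_in_has_derivative[OF smooth_xi2 s]
  note dY = smooth_in_has_derivative[OF smooth_AF_Y s]
  have X: "D I (AF_Y I \<xi>) s \<bullet> xi2 I \<xi> s = - AF_p I \<xi> s"
    using derivative_inner_const_eq[OF AF_orthonormal(2) s dX dY] AF_orthonormal[OF s]
    by (simp add: D_xi2_eq_AF s inner_commute)
  have Y: "D I (AF_Y I \<xi>) s \<bullet> AF_Y I \<xi> s = 0"
    using derivative_inner_const_eq[OF AF_orthonormal(1) s dY dY] by (simp add: inner_commute)
  have "D I (D I (xi2 I \<xi>)) s = D I (\<lambda>t. AF_p I \<xi> t *\<^sub>R AF_Y I \<xi> t) s"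
    using D_xi2_eq_AF s by (rule D_cong)
  also have "\<dots> = AF_p I \<xi> s *\<^sub>R D I (AF_Y I \<xi>) s + D I (AF_p I \<xi>) s *\<^sub>R AF_Y I \<xi> s"
    by (intro D_eq bounded_bilinear.has_vector_derivative[OF bounded_bilinear_scaleR]
        dY smooth_in_has_derivative[OF smooth_p] s)
  finally have "AF_p I \<xi> s * (D I (AF_Y I \<xi>) s \<bullet> AF_D I \<xi> s) = AF_p I \<xi> s * AF_q I \<xi> s"
    using D2_xi2_inner_AF_D[OF s] by (simp add: inner_simps AF_D_def dot_cross_self)
  then have "D I (AF_Y I \<xi>) s \<bullet> AF_D I \<xi> s = AF_q I \<xi> s"
    using p_pos[OF s] by simp
  then show ?thesis
    using orthonormal_expansion[OF frenet_frame_orthonormal(2)[OF s] AF_orthonormal[OF s],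
        of "D I (AF_Y I \<xi>) s"] X Y
    by (simp add: AF_D_def)
qed

lemma alternative_frame:
  assumes "\<And>s. s \<in> I \<Longrightarrow> AF_q I \<xi> s \<noteq> 0"
  shows "alternative_frame I (xi2 I \<xi>) (AF_Y I \<xi>) (AF_D I \<xi>) (AF_p I \<xi>) (AF_q I \<xi>)"
proof unfold_locales
  fix s assume s: "s \<in> I"
  show "(xi2 I \<xi> has_vector_derivative AF_p I \<xi> s *\<^sub>R AF_Y I \<xi> s) (at s within I)"
    using smooth_in_has_derivative[OF smooth_xi2 s] by (simp add: D_xi2_eq_AF s)
  show "(AF_Y I \<xi> has_vector_derivative AF_q I \<xi> s *\<^sub>R AF_D I \<xi> s - AF_p I \<xi> s *\<^sub>R xi2 I \<xi> s) (at s within I)"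
    using smooth_in_has_derivative[OF smooth_AF_Y s] by (simp add: D_AF_Y s)
  show "AF_p I \<xi> s \<noteq> 0" using p_pos[OF s] by simp
qed (simp_all add: frenet_frame_orthonormal AF_orthonormal AF_D_def smooth_p smooth_q assms)

end

section \<open>Slant helices and Darboux helices\<close>

theorem corollary14:
  fixes I :: "real set" and r \<xi> :: "real \<Rightarrow> real^3" and \<pi> :: "real \<Rightarrow> (real^3) set"
    and p q :: "real \<Rightarrow> real" and X :: "real \<Rightarrow> real^3"
  defines "p \<equiv> AF_p I \<xi>" and "q \<equiv> AF_q I \<xi>" and "X \<equiv> xi2 I \<xi>"
  assumes "myller_configuration I r \<xi> \<pi>"
    and "\<And>s. s \<in> I \<Longrightarrow> K1 I \<xi> s > 0"
    and "\<And>s. s \<in> I \<Longrightarrow> p s \<noteq> 0 \<and> q s \<noteq> 0"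
  shows "(slant_helix I \<xi> \<longleftrightarrow> darboux_helix I \<xi>) \<and>
    (slant_helix I \<xi> \<longleftrightarrow>
      (\<forall>s\<in>I.
        D I (D I (D I X)) s
        - (D I p s / p s + D I (\<lambda>t. p t * q t) s / (p s * q s)) *\<^sub>R D I (D I X) s
        + (p s * q s * D I (\<lambda>t. D I (\<lambda>u. 1 / p u) t * (1 / q t)) s + (p s)\<^sup>2 + (q s)\<^sup>2) *\<^sub>R D I X s
        = 0))"
proof -
  interpret curved_versor_field I \<xi>
    using assms(4,5) by unfold_locales (auto simp: myller_configuration_def)
  interpret alternative_frame I "xi2 I \<xi>" "AF_Y I \<xi>" "AF_D I \<xi>" "AF_p I \<xi>" "AF_q I \<xi>"
    using assms(6) by (intro alternative_frame) (simp add: q_def)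
  have "slant_helix I \<xi> \<longleftrightarrow> darboux_helix I \<xi>"
    unfolding slant_helix_def darboux_helix_def constant_angle_X_iff constant_angle_W_iff ..
  moreover note constant_angle_iff_differential_equation
  ultimately show ?thesis
    unfolding slant_helix_def p_def q_def X_def by blast
qed

end
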